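(* Let $n\geq 5$ be odd. The circulant graph $\mathrm{circ}(n;\pm1,\pm2)$ is not $3$-spanning cyclable.
   Context: $\mathrm{circ}(n;\pm1,\pm s)$ is the Cayley graph on $\mathbb{Z}/n\mathbb{Z}$ with connection set $\{\pm1,\pm s\}$: vertices $u_0,\dots,u_{n-1}$ (indices mod $n$), with $u_i$ adjacent to $u_{i\pm1}$ and $u_{i\pm s}$. A 2-factor of a graph is a spanning subgraph in which every vertex has valency 2; it separates a set $A$ of $k$ vertices if it consists of exactly $k$ cycles and $A$ meets the vertex set of each cycle in exactly one vertex. A graph $X$ is $k$-spanning cyclable if for every $A\subseteq V(X)$ with $|A|=k$ there is a 2-factor of $X$ separating $A$. *)

theory Defs
  imports "HOL-Algebra.Elementary_Groups"
begin

(* A graph is given by its vertices and its edges; an edge is the set of its two ends. *)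
record 'v graph =
  vertices :: "'v set"
  edges :: "'v set set"

(* The connection set is meant to be closed under inverses and not to contain the identity
   (the latter would contribute singleton "edges"). *)
definition cayley_graph :: "('v, 'm) monoid_scheme \<Rightarrow> 'v set \<Rightarrow> 'v graph" where
  "cayley_graph G S =
     \<lparr>vertices = carrier G, edges = {{g, g \<otimes>\<^bsub>G\<^esub> s} | g s. g \<in> carrier G \<and> s \<in> S}\<rparr>"

(* circ(n; +-1, +-s); residue classes modulo n are represented by 0, ..., n - 1. *)
definition circ :: "nat \<Rightarrow> int \<Rightarrow> int graph" where
  "circ n s = cayley_graph (integer_mod_group n) ((\<lambda>d. d mod int n) ` {1, -1, s, -s})"

definition valency :: "'v graph \<Rightarrow> 'v \<Rightarrow> nat" where
  "valency X v = card {e \<in> edges X. v \<in> e}"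

definition two_factor :: "'v graph \<Rightarrow> 'v graph \<Rightarrow> bool" where
  "two_factor F X \<longleftrightarrow>
     vertices F = vertices X \<and> edges F \<subseteq> edges X \<and> (\<forall>v \<in> vertices F. valency F v = 2)"

definition cycle_graph :: "'v graph \<Rightarrow> bool" where
  "cycle_graph C \<longleftrightarrow>
     (\<exists>p. distinct p \<and> length p \<ge> 3 \<and> vertices C = set p \<and>
          edges C = {{p ! i, p ! (Suc i mod length p)} | i. i < length p})"

definition consists_of_cycles :: "'v graph \<Rightarrow> 'v graph set \<Rightarrow> bool" where
  "consists_of_cycles F \<C> \<longleftrightarrow>
     (\<forall>C \<in> \<C>. cycle_graph C) \<and>
     (\<forall>C \<in> \<C>. \<forall>D \<in> \<C>. C \<noteq> D \<longrightarrow> vertices C \<inter> vertices D = {}) \<and>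
     vertices F = (\<Union>C \<in> \<C>. vertices C) \<and> edges F = (\<Union>C \<in> \<C>. edges C)"

definition separates :: "'v graph \<Rightarrow> 'v set \<Rightarrow> bool" where
  "separates F A \<longleftrightarrow>
     (\<exists>\<C>. finite \<C> \<and> card \<C> = card A \<and> consists_of_cycles F \<C> \<and>
           (\<forall>C \<in> \<C>. \<exists>!a. a \<in> A \<inter> vertices C))"

definition spanning_cyclable :: "nat \<Rightarrow> 'v graph \<Rightarrow> bool" where
  "spanning_cyclable k X \<longleftrightarrow>
     (\<forall>A \<subseteq> vertices X. finite A \<and> card A = k \<longrightarrow> (\<exists>F. two_factor F X \<and> separates F A))"

end

theory Submission
  imports Defs
begin

text \<open>The vertices \<open>0\<close>, \<open>1\<close>, \<open>2\<close> cannot be separated. They would lie on different cycles, so none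
  of the edges among them is used. Then the only neighbours left for \<open>0\<close> are \<open>-1\<close> and \<open>-2\<close>, and
  those left for \<open>1\<close> are \<open>-1\<close> and \<open>3\<close>; hence both \<open>0\<close> and \<open>1\<close> are joined to \<open>-1\<close> and lie on the
  same cycle after all.\<close>

lemma edges_circ:
  assumes "n > 0"
  shows "edges (circ n s) =
    {{g, (g + d) mod int n} | g d. g \<in> {0..<int n} \<and> d \<in> {1, -1, s, -s}}"
proof -
  have "edges (circ n s) = {{g, (g + r) mod int n} | g r.
      g \<in> {0..<int n} \<and> r \<in> (\<lambda>d. d mod int n) ` {1, -1, s, -s}}"
    using assms unfolding circ_def cayley_graph_def
    by (simp only: graph.simps carrier_integer_mod_group mult_integer_mod_group) simp
  also have "\<dots> = {{g, (g + d mod int n) mod int n} | g d.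
      g \<in> {0..<int n} \<and> d \<in> {1, -1, s, -s}}"
    by blast
  finally show ?thesis
    by (simp only: mod_add_right_eq)
qed

text \<open>The connection set is closed under negation, so either end of an edge can serve as its
  base point.\<close>

lemma circ_incident_edge:
  assumes n: "n > 0" and e: "e \<in> edges (circ n s)" and v: "v \<in> e"
  shows "\<exists>d \<in> {1, -1, s, -s}. e = {v, (v + d) mod int n}"
proof -
  obtain g d where g: "g \<in> {0..<int n}" and d: "d \<in> {1, -1, s, -s}"
    and e_eq: "e = {g, (g + d) mod int n}"
    using e unfolding edges_circ[OF n] by blast
  from v e_eq consider "v = g" | "v = (g + d) mod int n" by blast
  then show ?thesis
  proof cases
    case 1
    with d e_eq show ?thesis by blast
  next
    case 2
    \<comment> \<open>Stepping back by \<open>- d\<close> from the far end returns to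
      \<open>g\<close>, which is already a reduced residue.\<close>
    have "(v + - d) mod int n = (g + d + - d) mod int n"
      unfolding 2 by (rule mod_add_left_eq)
    then have "(v + - d) mod int n = g"
      using g by simp
    moreover have "e = {v, g}"
      using 2 e_eq by (simp only: insert_commute)
    ultimately have "e = {v, (v + - d) mod int n}"
      by (simp only:)
    moreover have "- d \<in> {1, -1, s, -s}"
      using d by force
    ultimately show ?thesis by blast
  qed
qed

lemma cycle_graph_edge_subset:
  assumes "cycle_graph C" and "e \<in> edges C"
  shows "e \<subseteq> vertices C"
proof -
  obtain p i where p: "vertices C = set p" and i: "i < length p"
    and e: "e = {p ! i, p ! (Suc i mod length p)}"
    using assms unfolding cycle_graph_def by auto
  have "Suc i mod length p < length p"
    using i by (intro mod_less_divisor) linarith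
  with p i e show ?thesis by simp
qed

text \<open>Distinct cycles are vertex-disjoint, so two edges with a common end lie on one cycle,
  and that cycle holds a single vertex of \<open>A\<close>. The case \<open>e = e'\<close> rules out
  edges of \<open>F\<close> between two vertices of \<open>A\<close>.\<close>

lemma separates_edge_inter:
  assumes "separates F A" and "e \<in> edges F" and "e' \<in> edges F" and "e \<inter> e' \<noteq> {}"
    and "a \<in> A" and "b \<in> A" and "a \<in> e" and "b \<in> e'"
  shows "a = b"
proof -
  obtain \<C> where c: "consists_of_cycles F \<C>"
    and u: "\<And>C. C \<in> \<C> \<Longrightarrow> \<exists>!a. a \<in> A \<inter> vertices C"
    using assms(1) unfolding separates_def by blast
  obtain C D where C: "C \<in> \<C>" "e \<in> edges C" and D: "D \<in> \<C>" "e' \<in> edges D"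
    using c assms(2,3) unfolding consists_of_cycles_def by auto
  have "cycle_graph C" "cycle_graph D"
    using c C(1) D(1) unfolding consists_of_cycles_def by simp_all
  then have sub: "e \<subseteq> vertices C" "e' \<subseteq> vertices D"
    using C(2) D(2) by (simp_all only: cycle_graph_edge_subset)
  then have "vertices C \<inter> vertices D \<noteq> {}"
    using assms(4) by blast
  then have "C = D"
    using c C(1) D(1) unfolding consists_of_cycles_def by blast
  with u[OF C(1)] sub assms(5-8) show ?thesis by blast
qed

text \<open>Valency 2 leaves no slack: once only two candidates for the edges at \<open>v\<close>
  remain, both must occur.\<close>

lemma two_factor_edges_at:
  assumes "two_factor F X" and "v \<in> vertices X"
    and "\<And>e. e \<in> edges F \<Longrightarrow> v \<in> e \<Longrightarrow> e = e\<^sub>1 \<or> e = e\<^sub>2"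
  shows "e\<^sub>1 \<in> edges F"
proof -
  have "card {e \<in> edges F. v \<in> e} = 2"
    using assms(1,2) unfolding two_factor_def valency_def by auto
  moreover have "{e \<in> edges F. v \<in> e} \<subseteq> {e\<^sub>1, e\<^sub>2}"
    using assms(3) by auto
  \<comment> \<open>A set of two elements inside a set of at most two elements is all of it.\<close>
  moreover have "card {e\<^sub>1, e\<^sub>2} \<le> 2"
    by (simp add: card_insert_if)
  ultimately have "{e \<in> edges F. v \<in> e} = {e\<^sub>1, e\<^sub>2}"
    by (intro card_seteq) auto
  then show ?thesis by blast
qed

theorem theorem5p2:
  fixes n :: nat
  assumes "n \<ge> 5" and "odd n"
  shows "\<not> spanning_cyclable 3 (circ n 2)"
proof
  assume sc: "spanning_cyclable 3 (circ n 2)"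
  let ?A = "{0, 1, 2} :: int set"
  have V: "vertices (circ n 2) = {0..<int n}"
    using assms(1) by (simp add: circ_def cayley_graph_def carrier_integer_mod_group)
  then have "?A \<subseteq> vertices (circ n 2)"
    using assms(1) by auto
  moreover have "finite ?A" "card ?A = 3" by simp_all
  ultimately obtain F where F: "two_factor F (circ n 2)" and sep: "separates F ?A"
    using sc unfolding spanning_cyclable_def by blast
  \<comment> \<open>These are the reduced forms of all neighbours of 0 and 1;
    \<open>n \<ge> 5\<close> ensures that 3 is its own residue.\<close>
  have mods: "- 1 mod int n = int n - 1" "- 2 mod int n = int n - 2"
    "1 mod int n = 1" "2 mod int n = 2" "3 mod int n = 3"
    using assms(1) by (simp_all add: zmod_minus1 zmod_zminus1_eq_if)
  have edge: "\<exists>d \<in> {1, -1, 2, -2}. e = {v, (v + d) mod int n}" if "e \<in> edges F" "v \<in> e" for e v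
    using circ_incident_edge[of n e 2 v] that F assms(1) unfolding two_factor_def by auto
  have independent: "{a, b} \<notin> edges F" if "a \<in> ?A" "b \<in> ?A" "a \<noteq> b" for a b
    using separates_edge_inter[OF sep, of "{a, b}" "{a, b}" a b] that by blast
  have "{0, int n - 1} \<in> edges F"
  proof (rule two_factor_edges_at[OF F])
    show "0 \<in> vertices (circ n 2)" using V assms(1) by simp
    \<comment> \<open>The steps 1 and 2 from 0 end in \<open>?A\<close> and are excluded; the steps
      -1 and -2 remain.\<close>
    show "e = {0, int n - 1} \<or> e = {0, int n - 2}" if "e \<in> edges F" "0 \<in> e" for e
      using edge[OF that] independent[of 0 1] independent[of 0 2] that(1) by (auto simp: mods)
  qed
  moreover have "{1, int n - 1} \<in> edges F"
  proof (rule two_factor_edges_at[OF F])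
    show "1 \<in> vertices (circ n 2)" using V assms(1) by simp
    \<comment> \<open>From 1 it is the steps -1 and 1 that end in \<open>?A\<close>; the step -2
      leads to \<open>int n - 1\<close>.\<close>
    show "e = {1, int n - 1} \<or> e = {1, 3}" if "e \<in> edges F" "1 \<in> e" for e
      using edge[OF that] independent[of 1 0] independent[of 1 2] that(1) by (auto simp: mods)
  qed
  ultimately have "(0::int) = 1"
    using separates_edge_inter[OF sep, of "{0, int n - 1}" "{1, int n - 1}" 0 1] by simp
  then show False by simp
qed

end
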